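(* Let $X$ be a finite non-empty set and $P\in\mathfrak{P}(X)$. If $P$ has the 3-chain-property, then $P$ is $\mathfrak{L}$-shielded. Moreover, if $P$ has an FPP-graph, then the converse also holds: if $P$ is $\mathfrak{L}$-shielded, then $P$ has the 3-chain-property.
   Context: For a finite non-empty set $X$, $\mathfrak{P}(X)$ is the set of all partial orders (posets) with carrier $X$, ordered by $P\sqsubseteq Q$ iff $\leq_P\subseteq\leq_Q$ (as subsets of $X\times X$); $\mathfrak{L}(P)$ denotes the set of lower covers of $P$ in $(\mathfrak{P}(X),\sqsubseteq)$. For a poset $P$: $<_P$ is the strict order; $[x,y]_P=\{z: x\leq_P z\leq_P y\}$; $x\lessdot_P y$ means $x<_P y$ and $[x,y]_P=\{x,y\}$; $L(P)$ and $U(P)$ are the sets of minimal and maximal elements, $M(P)=X\setminus(L(P)\cup U(P))$; $\prec_P=\{(a,b)\in <_P : M(P)\cap[a,b]_P=\emptyset\}$ (equivalently $\lessdot_P\cap(L(P)\times U(P))$). For $(a,b)\in X\times X$, $P\setminus(a,b)$ denotes $(X,\leq_P\setminus\{(a,b)\})$. $P$ is connected iff its comparability graph is connected. $P$ has an FPP-graph iff $P$ is connected and $P\setminus(a,b)$ is disconnected for every $(a,b)\in\prec_P$. $P$ is $\mathfrak{L}$-shielded iff no poset in $\mathfrak{L}(P)$ has an FPP-graph. A point $p$ is I-retractable to $q$ in $P$ iff $q$ is the maximum of $\{z: z<_P p\}$ or $q$ is the minimum of $\{z : p<_P z\}$. For $(a,b)\in\lessdot_P$ such that $Q:=P\setminus(a,b)$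 is connected, the pair $(a,b)$ has the 3-chain-property iff there exists $(x,y)\in\lessdot_Q$ such that $Q\setminus(x,y)$ is connected and the subposet of $P$ induced on $\{a,b,x,y\}$ is a chain $u\lessdot_P v\lessdot_P w$ with $u\in L(P)$, $w\in U(P)$ (a maximal chain of $P$), satisfying: (i) if $(x,y)\in L(P)\times U(P)$ then $[u,w]_P=\{u,v,w\}$; (ii) if $x\in M(P)$ then $b$ is I-retractable to $a$ in $P$; (iii) if $y\in M(P)$ then $a$ is I-retractable to $b$ in $P$. The poset $P$ has the 3-chain-property iff every $(a,b)\in\lessdot_P$ with $P\setminus(a,b)$ connected has the 3-chain-property. *)

theory Defs
  imports Main
begin

text \<open>
  A poset on the carrier \<open>X\<close> is represented by its reflexive order relation
  \<open>P \<subseteq> X \<times> X\<close>; the order \<open>\<sqsubseteq>\<close> on posets is then set inclusion,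
  and \<open>P - {(a, b)}\<close> is the removal of the pair \<open>(a, b)\<close> from the order.
\<close>

definition posets_on :: "'a set \<Rightarrow> 'a rel set" where
  "posets_on X = {P. partial_order_on X P}"

definition lower_covers :: "'a set \<Rightarrow> 'a rel \<Rightarrow> 'a rel set" where
  "lower_covers X P =
    {Q \<in> posets_on X. Q \<subset> P \<and> {R \<in> posets_on X. Q \<subseteq> R \<and> R \<subseteq> P} = {Q, P}}"

definition strict :: "'a rel \<Rightarrow> 'a rel" where
  "strict P = {(x, y). (x, y) \<in> P \<and> x \<noteq> y}"

definition interval :: "'a rel \<Rightarrow> 'a \<Rightarrow> 'a \<Rightarrow> 'a set" where
  "interval P x y = {z. (x, z) \<in> P \<and> (z, y) \<in> P}"

definition covering :: "'a rel \<Rightarrow> 'a rel" where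
  "covering P = {(x, y). (x, y) \<in> strict P \<and> interval P x y = {x, y}}"

definition minimals :: "'a set \<Rightarrow> 'a rel \<Rightarrow> 'a set" where
  "minimals X P = {x \<in> X. \<not> (\<exists>y. (y, x) \<in> strict P)}"

definition maximals :: "'a set \<Rightarrow> 'a rel \<Rightarrow> 'a set" where
  "maximals X P = {x \<in> X. \<not> (\<exists>y. (x, y) \<in> strict P)}"

definition middles :: "'a set \<Rightarrow> 'a rel \<Rightarrow> 'a set" where
  "middles X P = X - (minimals X P \<union> maximals X P)"

definition prec :: "'a set \<Rightarrow> 'a rel \<Rightarrow> 'a rel" where
  "prec X P = {(a, b). (a, b) \<in> strict P \<and> middles X P \<inter> interval P a b = {}}"

definition comparability_graph :: "'a rel \<Rightarrow> 'a rel" where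
  "comparability_graph P = {(x, y). (x, y) \<in> strict P \<or> (y, x) \<in> strict P}"

definition poset_connected :: "'a set \<Rightarrow> 'a rel \<Rightarrow> bool" where
  "poset_connected X P \<longleftrightarrow> (\<forall>x\<in>X. \<forall>y\<in>X. (x, y) \<in> (comparability_graph P)\<^sup>*)"

definition has_FPP_graph :: "'a set \<Rightarrow> 'a rel \<Rightarrow> bool" where
  "has_FPP_graph X P \<longleftrightarrow>
    poset_connected X P \<and> (\<forall>(a, b)\<in>prec X P. \<not> poset_connected X (P - {(a, b)}))"

definition L_shielded :: "'a set \<Rightarrow> 'a rel \<Rightarrow> bool" where
  "L_shielded X P \<longleftrightarrow> \<not> (\<exists>Q\<in>lower_covers X P. has_FPP_graph X Q)"

definition is_maximum :: "'a rel \<Rightarrow> 'a set \<Rightarrow> 'a \<Rightarrow> bool" where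
  "is_maximum P A q \<longleftrightarrow> q \<in> A \<and> (\<forall>z\<in>A. (z, q) \<in> P)"

definition is_minimum :: "'a rel \<Rightarrow> 'a set \<Rightarrow> 'a \<Rightarrow> bool" where
  "is_minimum P A q \<longleftrightarrow> q \<in> A \<and> (\<forall>z\<in>A. (q, z) \<in> P)"

definition I_retractable :: "'a rel \<Rightarrow> 'a \<Rightarrow> 'a \<Rightarrow> bool" where
  "I_retractable P p q \<longleftrightarrow>
    is_maximum P {z. (z, p) \<in> strict P} q \<or> is_minimum P {z. (p, z) \<in> strict P} q"

definition pair_three_chain_property :: "'a set \<Rightarrow> 'a rel \<Rightarrow> 'a \<Rightarrow> 'a \<Rightarrow> bool" where
  "pair_three_chain_property X P a b \<longleftrightarrow>
    (\<exists>(x, y) \<in> covering (P - {(a, b)}).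
      poset_connected X (P - {(a, b)} - {(x, y)}) \<and>
      (\<exists>u v w. {a, b, x, y} = {u, v, w} \<and>
        (u, v) \<in> covering P \<and> (v, w) \<in> covering P \<and>
        u \<in> minimals X P \<and> w \<in> maximals X P \<and>
        ((x, y) \<in> minimals X P \<times> maximals X P \<longrightarrow> interval P u w = {u, v, w}) \<and>
        (x \<in> middles X P \<longrightarrow> I_retractable P b a) \<and>
        (y \<in> middles X P \<longrightarrow> I_retractable P a b)))"

definition three_chain_property :: "'a set \<Rightarrow> 'a rel \<Rightarrow> bool" where
  "three_chain_property X P \<longleftrightarrow>
    (\<forall>(a, b) \<in> covering P.
      poset_connected X (P - {(a, b)}) \<longrightarrow> pair_three_chain_property X P a b)"

end

theory Submission
  imports Defs
begin

text \<open>
  The lower covers of \<open>P\<close> are exactly the relations \<open>P - {(a, b)}\<close> with \<open>(a, b)\<close> a covering pair.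
  For such a connected \<open>Q = P - {(a, b)}\<close>, failure of the FPP-graph property is
  witnessed by some \<open>(x, y) \<in> prec X Q\<close> with \<open>Q - {(x, y)}\<close> connected, and \<open>prec\<close> consists of the
  covering pairs from a minimal to a maximal point. A pair satisfying the 3-chain conditions is such
  a witness because \<open>I\<close>-retractability makes the middle point of the chain extremal in \<open>Q\<close>. Conversely,
  if \<open>P\<close> has an FPP-graph, a witness cannot lie in \<open>prec X P\<close>, so the removal of \<open>(a, b)\<close> made it
  extremal or covering, and this forces \<open>a, b, x, y\<close> to form a maximal 3-chain.
\<close>

section \<open>Partial orders and covering pairs\<close>

lemma posets_onD:
  assumes "P \<in> posets_on X"
  shows "P \<subseteq> X \<times> X"
    and "x \<in> X \<Longrightarrow> (x, x) \<in> P"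
    and "(x, y) \<in> P \<Longrightarrow> (y, z) \<in> P \<Longrightarrow> (x, z) \<in> P"
    and "(x, y) \<in> P \<Longrightarrow> (y, x) \<in> P \<Longrightarrow> x = y"
  using assms unfolding posets_on_def partial_order_on_def preorder_on_def
  by (auto dest: refl_onD transD antisymD)

lemma posets_onI:
  assumes "P \<subseteq> X \<times> X"
    and "\<And>x. x \<in> X \<Longrightarrow> (x, x) \<in> P"
    and "\<And>x y z. (x, y) \<in> P \<Longrightarrow> (y, z) \<in> P \<Longrightarrow> (x, z) \<in> P"
    and "\<And>x y. (x, y) \<in> P \<Longrightarrow> (y, x) \<in> P \<Longrightarrow> x = y"
  shows "P \<in> posets_on X"
  using assms unfolding posets_on_def partial_order_on_def preorder_on_def
  by (blast intro: refl_onI transI antisymI)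

lemma coveringD:
  assumes "(a, b) \<in> covering P"
  shows "(a, b) \<in> P" and "a \<noteq> b"
    and "(a, z) \<in> P \<Longrightarrow> (z, b) \<in> P \<Longrightarrow> z = a \<or> z = b"
  using assms unfolding covering_def strict_def interval_def by auto

lemma coveringI:
  assumes "P \<in> posets_on X" and "(a, b) \<in> P" and "a \<noteq> b"
    and "\<And>z. (a, z) \<in> P \<Longrightarrow> (z, b) \<in> P \<Longrightarrow> z = a \<or> z = b"
  shows "(a, b) \<in> covering P"
proof -
  have "(a, a) \<in> P" "(b, b) \<in> P"
    using assms(2) posets_onD(1,2)[OF assms(1)] by blast+
  then show ?thesis
    using assms(2-) unfolding covering_def strict_def interval_def by blast
qed

section \<open>Lower covers as deletions of one covering pair\<close>

lemma poset_remove_covering: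
  assumes P: "P \<in> posets_on X" and ab: "(a, b) \<in> covering P"
  shows "P - {(a, b)} \<in> posets_on X"
proof (rule posets_onI)
  show "P - {(a, b)} \<subseteq> X \<times> X"
    using posets_onD(1)[OF P] by blast
  show "(x, x) \<in> P - {(a, b)}" if "x \<in> X" for x
    using posets_onD(2)[OF P that] coveringD(2)[OF ab] by blast
  \<comment> \<open>A composite could only be the deleted pair if \<open>x = a\<close> and
    \<open>z = b\<close>; then \<open>y\<close> is \<open>a\<close> or \<open>b\<close>, so one of
    the two factors is itself \<open>(a, b)\<close>.\<close>
  show "(x, z) \<in> P - {(a, b)}" if "(x, y) \<in> P - {(a, b)}" "(y, z) \<in> P - {(a, b)}" for x y z
    using posets_onD(3)[OF P, of x y z] coveringD(3)[OF ab, of y] that by blast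
  show "x = y" if "(x, y) \<in> P - {(a, b)}" "(y, x) \<in> P - {(a, b)}" for x y
    using posets_onD(4)[OF P] that by blast
qed

text \<open>A finite order is generated by its covering pairs: a strict pair that is not covering
  splits at an intermediate point into two pairs with strictly smaller intervals, and transitivity
  of \<open>Q\<close> glues them together again.\<close>

lemma poset_eqI_covering:
  assumes "finite X" and P: "P \<in> posets_on X" and Q: "Q \<in> posets_on X"
    and "Q \<subseteq> P" and cov: "covering P \<subseteq> Q"
  shows "Q = P"
proof -
  have fin: "finite (interval P x y)" for x y
    by (rule finite_subset[OF _ \<open>finite X\<close>])
      (use posets_onD(1)[OF P] in \<open>auto simp: interval_def\<close>)
  have "(x, y) \<in> Q" if "(x, y) \<in> P" for x y
    using that
  proof (induction "card (interval P x y)" arbitrary: x y rule: less_induct)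
    case less
    have xX: "x \<in> X" and yX: "y \<in> X"
      using less.prems posets_onD(1)[OF P] by auto
    consider "x = y" | "(x, y) \<in> covering P"
      | z where "(x, z) \<in> P" "(z, y) \<in> P" "z \<noteq> x" "z \<noteq> y"
      using coveringI[OF P less.prems] by blast
    then show ?case
    proof cases
      case 1
      then show ?thesis using posets_onD(2)[OF Q xX] by simp
    next
      case 2
      then show ?thesis using cov by blast
    next
      case 3
      have "interval P x z \<subset> interval P x y"
      proof (rule psubsetI)
        show "interval P x z \<subseteq> interval P x y"
          unfolding interval_def using posets_onD(3)[OF P] 3 by blast
        have "y \<in> interval P x y" "y \<notin> interval P x z"
          unfolding interval_def
          using less.prems posets_onD(2)[OF P yX] posets_onD(4)[OF P] 3 by blast+
        then show "interval P x z \<noteq> interval P x y" by blast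
      qed
      moreover have "interval P z y \<subset> interval P x y"
      proof (rule psubsetI)
        show "interval P z y \<subseteq> interval P x y"
          unfolding interval_def using posets_onD(3)[OF P] 3 by blast
        have "x \<in> interval P x y" "x \<notin> interval P z y"
          unfolding interval_def
          using less.prems posets_onD(2)[OF P xX] posets_onD(4)[OF P] 3 by blast+
        then show "interval P z y \<noteq> interval P x y" by blast
      qed
      ultimately have "(x, z) \<in> Q" "(z, y) \<in> Q"
        using less.hyps 3 psubset_card_mono[OF fin] by blast+
      then show ?thesis by (rule posets_onD(3)[OF Q])
    qed
  qed
  then show ?thesis using \<open>Q \<subseteq> P\<close> by auto
qed

text \<open>By \<open>poset_eqI_covering\<close> a lower cover misses some covering pair. Deleting
  just that pair gives a poset between the lower cover and \<open>P\<close>, which must then be the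
  lower cover itself.\<close>

lemma lower_covers_eq:
  assumes "finite X" and P: "P \<in> posets_on X"
  shows "lower_covers X P = {P - {(a, b)} | a b. (a, b) \<in> covering P}"
proof (intro equalityI subsetI)
  fix Q assume Q: "Q \<in> lower_covers X P"
  then have Qp: "Q \<in> posets_on X" and sub: "Q \<subset> P"
    and btw: "{R \<in> posets_on X. Q \<subseteq> R \<and> R \<subseteq> P} = {Q, P}"
    unfolding lower_covers_def by auto
  have "\<not> covering P \<subseteq> Q"
    using poset_eqI_covering[OF \<open>finite X\<close> P Qp] sub by blast
  then obtain a b where ab: "(a, b) \<in> covering P" "(a, b) \<notin> Q" by auto
  have "P - {(a, b)} \<in> {R \<in> posets_on X. Q \<subseteq> R \<and> R \<subseteq> P}"
    using poset_remove_covering[OF P ab(1)] ab(2) sub by blast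
  then have "P - {(a, b)} \<in> {Q, P}" unfolding btw .
  then have "Q = P - {(a, b)}" using coveringD(1)[OF ab(1)] by blast
  then show "Q \<in> {P - {(a, b)} | a b. (a, b) \<in> covering P}" using ab by blast
next
  fix Q assume "Q \<in> {P - {(a, b)} | a b. (a, b) \<in> covering P}"
  then obtain a b where Q: "Q = P - {(a, b)}" and ab: "(a, b) \<in> covering P" by blast
  show "Q \<in> lower_covers X P"
    using poset_remove_covering[OF P ab] coveringD(1)[OF ab] P
    unfolding lower_covers_def Q by auto
qed

section \<open>FPP-graphs and shieldedness through covering pairs\<close>

lemma prec_eq:
  assumes P: "P \<in> posets_on X"
  shows "prec X P = covering P \<inter> (minimals X P \<times> maximals X P)"
proof (intro equalityI subrelI)
  fix x y assume "(x, y) \<in> prec X P"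
  then have xy: "(x, y) \<in> P" "x \<noteq> y" and mid: "middles X P \<inter> interval P x y = {}"
    unfolding prec_def strict_def by auto
  have X: "x \<in> X" "y \<in> X" using xy posets_onD(1)[OF P] by auto
  then have "x \<in> interval P x y" "y \<in> interval P x y"
    using xy posets_onD(2)[OF P] unfolding interval_def by auto
  \<comment> \<open>Since \<open>x\<close> lies strictly below \<open>y\<close>, \<open>x\<close> is
    not maximal and \<open>y\<close> is not minimal, so not being middle points leaves only one
    option for each.\<close>
  then have "x \<notin> middles X P" "y \<notin> middles X P" using mid by auto
  then have "x \<in> minimals X P" "y \<in> maximals X P"
    using xy X unfolding middles_def minimals_def maximals_def strict_def by blast+
  moreover have "(x, y) \<in> covering P"
  proof (rule coveringI[OF P xy])
    fix z assume z: "(x, z) \<in> P" "(z, y) \<in> P"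
    then have "z \<in> X" "z \<notin> middles X P"
      using posets_onD(1)[OF P] mid unfolding interval_def by auto
    then show "z = x \<or> z = y"
      using z unfolding middles_def minimals_def maximals_def strict_def by blast
  qed
  ultimately show "(x, y) \<in> covering P \<inter> (minimals X P \<times> maximals X P)" by blast
next
  fix x y assume "(x, y) \<in> covering P \<inter> (minimals X P \<times> maximals X P)"
  then show "(x, y) \<in> prec X P"
    unfolding prec_def covering_def middles_def by auto
qed

lemma poset_connected_mono:
  assumes "poset_connected X P" and "P \<subseteq> Q"
  shows "poset_connected X Q"
proof -
  have "comparability_graph P \<subseteq> comparability_graph Q"
    using assms(2) unfolding comparability_graph_def strict_def by blast
  then show ?thesis
    using assms(1) rtrancl_mono unfolding poset_connected_def by blast
qed

lemma has_FPP_graph_iff: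
  assumes "P \<in> posets_on X"
  shows "has_FPP_graph X P \<longleftrightarrow> poset_connected X P \<and>
    (\<forall>x y. (x, y) \<in> covering P \<and> x \<in> minimals X P \<and> y \<in> maximals X P \<longrightarrow>
      \<not> poset_connected X (P - {(x, y)}))"
  unfolding has_FPP_graph_def prec_eq[OF assms] by auto

text \<open>Disconnected lower covers never have an FPP-graph, so only connected ones need a
  removable extremal pair. This matches the quantifiers of
  \<open>three_chain_property\<close>.\<close>

lemma L_shielded_iff:
  assumes "finite X" and P: "P \<in> posets_on X"
  shows "L_shielded X P \<longleftrightarrow>
    (\<forall>a b. (a, b) \<in> covering P \<and> poset_connected X (P - {(a, b)}) \<longrightarrow>
      (\<exists>x y. (x, y) \<in> covering (P - {(a, b)}) \<and>
        x \<in> minimals X (P - {(a, b)}) \<and> y \<in> maximals X (P - {(a, b)}) \<and>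
        poset_connected X (P - {(a, b)} - {(x, y)})))"
  unfolding L_shielded_def lower_covers_eq[OF assms]
  using has_FPP_graph_iff[OF poset_remove_covering[OF P]] by blast

section \<open>Maximal 3-chains and extremal covering pairs of a lower cover\<close>

lemma three_chain_pair_extremal:
  assumes P: "P \<in> posets_on X" and ab: "(a, b) \<in> covering P"
    and xy: "(x, y) \<in> covering (P - {(a, b)})"
    and chain: "{a, b, x, y} = {u, v, w}" "(u, v) \<in> covering P" "(v, w) \<in> covering P"
    and u: "u \<in> minimals X P" and w: "w \<in> maximals X P"
    and retr_x: "x \<in> middles X P \<Longrightarrow> I_retractable P b a"
    and retr_y: "y \<in> middles X P \<Longrightarrow> I_retractable P a b"
  shows "x \<in> minimals X (P - {(a, b)}) \<and> y \<in> maximals X (P - {(a, b)})"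
proof -
  note D = coveringD
  have uv: "(u, v) \<in> P" "u \<noteq> v" and vw: "(v, w) \<in> P" "v \<noteq> w"
    using D(1,2)[OF chain(2)] D(1,2)[OF chain(3)] by auto
  have v: "v \<in> middles X P"
    using uv vw posets_onD(1)[OF P]
    unfolding middles_def minimals_def maximals_def strict_def by blast
  have not_below: "z = u" if "(z, u) \<in> P" for z
    using u that unfolding minimals_def strict_def by auto
  have not_above: "z = w" if "(w, z) \<in> P" for z
    using w that unfolding maximals_def strict_def by auto
  have min_u: "u \<in> minimals X (P - {(a, b)})" and max_w: "w \<in> maximals X (P - {(a, b)})"
    using u w unfolding minimals_def maximals_def strict_def by auto
  have abP: "(a, b) \<in> P" "a \<noteq> b" and ab_in: "a \<in> {u, v, w}" "b \<in> {u, v, w}"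
    using D(1,2)[OF ab] chain(1) by auto
  have xyP: "(x, y) \<in> P" "(x, y) \<noteq> (a, b)" "x \<noteq> y" and xy_in: "x \<in> {u, v, w}" "y \<in> {u, v, w}"
    using D(1,2)[OF xy] chain(1) by auto
  have pairs: "(p, q) \<in> {(u, v), (v, w), (u, w)}"
    if "(p, q) \<in> P" "p \<noteq> q" "p \<in> {u, v, w}" "q \<in> {u, v, w}" for p q
    using that not_below not_above uv vw posets_onD(4)[OF P] by blast
  \<comment> \<open>The point \<open>v\<close> lies strictly between \<open>u\<close> and
    \<open>w\<close>, so the covering pair must be one of the two links of the chain.\<close>
  have "(a, b) \<noteq> (u, w)"
    using D(3)[OF ab, of v] uv vw by blast
  then consider "a = u" "b = v" | "a = v" "b = w"
    using pairs[OF abP ab_in] by blast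
  then show ?thesis
  proof cases
    case 1
    then consider "x = v" "y = w" | "x = u" "y = w"
      using pairs[OF xyP(1,3) xy_in] xyP(2) by blast
    then show ?thesis
    proof cases
      assume xy': "x = v" "y = w"
      have "I_retractable P v u" using retr_x v xy' 1 by simp
      \<comment> \<open>The minimum alternative would put \<open>u\<close> above \<open>v\<close>.
        So \<open>u\<close> is the maximum of the points below \<open>v\<close>; being minimal, it
        is the only one, and deleting \<open>(u, v)\<close> makes \<open>v\<close> minimal.\<close>
      then have "(z, u) \<in> P" if "(z, v) \<in> P" "z \<noteq> v" for z
        using that uv posets_onD(4)[OF P]
        unfolding I_retractable_def is_maximum_def is_minimum_def strict_def by blast
      then have "v \<in> minimals X (P - {(a, b)})"
        using not_below v 1 unfolding minimals_def middles_def strict_def by blast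
      then show ?thesis using max_w xy' by simp
    qed (use min_u max_w in simp)
  next
    case 2
    then consider "x = u" "y = v" | "x = u" "y = w"
      using pairs[OF xyP(1,3) xy_in] xyP(2) by blast
    then show ?thesis
    proof cases
      assume xy': "x = u" "y = v"
      have "I_retractable P v w" using retr_y v xy' 2 by simp
      then have "(w, z) \<in> P" if "(v, z) \<in> P" "z \<noteq> v" for z
        using that vw posets_onD(4)[OF P]
        unfolding I_retractable_def is_maximum_def is_minimum_def strict_def by blast
      then have "v \<in> maximals X (P - {(a, b)})"
        using not_above v 2 unfolding maximals_def middles_def strict_def by blast
      then show ?thesis using min_u xy' by simp
    qed (use min_u max_w in simp)
  qed
qed

text \<open>The deletion can make only \<open>b\<close> newly minimal and only \<open>a\<close>
  newly maximal. If neither explains why \<open>(x, y)\<close> is new, then \<open>(x, y)\<close>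
  became covering because its sole intermediate point was linked to \<open>x\<close> or
  \<open>y\<close> by the deleted pair. The chains are \<open>a, b, y\<close>, then
  \<open>x, a, b\<close>, then \<open>x, z, y\<close>.\<close>

lemma extremal_pair_three_chain:
  assumes P: "P \<in> posets_on X" and ab: "(a, b) \<in> covering P"
    and xy: "(x, y) \<in> covering (P - {(a, b)})"
    and xmin: "x \<in> minimals X (P - {(a, b)})" and ymax: "y \<in> maximals X (P - {(a, b)})"
    and not_prec: "(x, y) \<notin> covering P \<inter> (minimals X P \<times> maximals X P)"
  shows "\<exists>u v w. {a, b, x, y} = {u, v, w} \<and>
    (u, v) \<in> covering P \<and> (v, w) \<in> covering P \<and>
    u \<in> minimals X P \<and> w \<in> maximals X P \<and>
    ((x, y) \<in> minimals X P \<times> maximals X P \<longrightarrow> interval P u w = {u, v, w}) \<and>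
    (x \<in> middles X P \<longrightarrow> I_retractable P b a) \<and>
    (y \<in> middles X P \<longrightarrow> I_retractable P a b)"
proof -
  have abP: "(a, b) \<in> P" "a \<noteq> b" and xyP: "(x, y) \<in> P" "(x, y) \<noteq> (a, b)" "x \<noteq> y"
    using coveringD(1,2)[OF ab] coveringD(1,2)[OF xy] by auto
  have X: "a \<in> X" "b \<in> X" "x \<in> X" "y \<in> X"
    using abP xyP posets_onD(1)[OF P] by auto
  have below_x: "z = x \<or> (z = a \<and> x = b)" if "(z, x) \<in> P" for z
    using xmin that unfolding minimals_def strict_def by blast
  have above_y: "z = y \<or> (z = b \<and> y = a)" if "(y, z) \<in> P" for z
    using ymax that unfolding maximals_def strict_def by blast
  have between: "z = x \<or> z = y \<or> (x = a \<and> z = b) \<or> (z = a \<and> y = b)"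
    if "(x, z) \<in> P" "(z, y) \<in> P" for z
    using coveringD(3)[OF xy, of z] that by blast
  note trans = posets_onD(3)[OF P] and antisym = posets_onD(4)[OF P]
  consider (low) "x \<notin> minimals X P" | (up) "y \<notin> maximals X P"
    | (both) "x \<in> minimals X P" "y \<in> maximals X P"
    by blast
  then show ?thesis
  proof cases
    case low
    then have xb: "x = b"
      using below_x X unfolding minimals_def strict_def by blast
    \<comment> \<open>A point below \<open>a\<close> is also below \<open>b\<close>, hence is
      \<open>a\<close> or \<open>b\<close>, and antisymmetry excludes \<open>b\<close>.\<close>
    have a_min: "a \<in> minimals X P"
      using below_x xb abP trans antisym X unfolding minimals_def strict_def by blast
    have "y \<noteq> a" using antisym abP xyP xb by blast
    then have y_max: "y \<in> maximals X P"
      using above_y X unfolding maximals_def strict_def by blast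
    have by_cov: "(b, y) \<in> covering P"
      using coveringI[OF P, of b y] between xyP xb abP antisym by blast
    have retr: "I_retractable P b a"
      using below_x xb abP posets_onD(2)[OF P X(1)]
      unfolding I_retractable_def is_maximum_def strict_def by blast
    \<comment> \<open>The interval condition and the condition on \<open>y\<close> hold vacuously
      here: \<open>x\<close> is not minimal and \<open>y\<close> is maximal.\<close>
    show ?thesis
      by (rule exI[of _ a], rule exI[of _ b], rule exI[of _ y])
        (use ab by_cov a_min y_max retr low xb in \<open>auto simp: middles_def\<close>)
  next
    case up
    then have ya: "y = a"
      using above_y X unfolding maximals_def strict_def by blast
    have b_max: "b \<in> maximals X P"
      using above_y ya abP trans antisym X unfolding maximals_def strict_def by blast
    have "x \<noteq> b" using antisym abP xyP ya by blast
    then have x_min: "x \<in> minimals X P"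
      using below_x X unfolding minimals_def strict_def by blast
    have xa_cov: "(x, a) \<in> covering P"
      using coveringI[OF P, of x a] between xyP ya abP antisym by blast
    have retr: "I_retractable P a b"
      using above_y ya abP posets_onD(2)[OF P X(2)]
      unfolding I_retractable_def is_minimum_def strict_def by blast
    show ?thesis
      by (rule exI[of _ x], rule exI[of _ a], rule exI[of _ b])
        (use ab xa_cov b_max x_min retr up ya in \<open>auto simp: middles_def\<close>)
  next
    case both
    then obtain z where z: "(x, z) \<in> P" "(z, y) \<in> P" "z \<noteq> x" "z \<noteq> y"
      using not_prec coveringI[OF P xyP(1,3)] by blast
    have refl: "(x, x) \<in> P" "(y, y) \<in> P" using posets_onD(2)[OF P] X by auto
    \<comment> \<open>An intermediate point is \<open>b\<close> with \<open>x = a\<close>, or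
      \<open>a\<close> with \<open>y = b\<close>. Two different ones would need both cases, that is
      \<open>(x, y) = (a, b)\<close>.\<close>
    have only_z: "t = x \<or> t = y \<or> t = z" if "(x, t) \<in> P" "(t, y) \<in> P" for t
      using between[OF that] between[OF z(1,2)] z xyP by blast
    have "(x, z) \<in> covering P"
      using coveringI[OF P z(1)] only_z trans antisym z by metis
    moreover have "(z, y) \<in> covering P"
      using coveringI[OF P z(2)] only_z trans antisym z by metis
    moreover have "interval P x y = {x, z, y}"
      using only_z z xyP refl unfolding interval_def by blast
    moreover have "{a, b, x, y} = {x, z, y}"
      using between[OF z(1,2)] z by auto
    ultimately show ?thesis
      using both unfolding middles_def by blast
  qed
qed

theorem theorem1:
  fixes X :: "'a set" and P :: "'a rel"
  assumes "finite X" and "X \<noteq> {}" and "P \<in> posets_on X"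
  shows "(three_chain_property X P \<longrightarrow> L_shielded X P) \<and>
    (has_FPP_graph X P \<longrightarrow> L_shielded X P \<longrightarrow> three_chain_property X P)"
proof (intro conjI impI)
  note P = \<open>P \<in> posets_on X\<close>
  assume tcp: "three_chain_property X P"
  show "L_shielded X P"
    unfolding L_shielded_iff[OF \<open>finite X\<close> P]
  proof (intro allI impI, elim conjE)
    fix a b
    assume ab: "(a, b) \<in> covering P" and "poset_connected X (P - {(a, b)})"
    then have "pair_three_chain_property X P a b"
      using tcp unfolding three_chain_property_def by blast
    then obtain x y u v w where
      xy: "(x, y) \<in> covering (P - {(a, b)})" "poset_connected X (P - {(a, b)} - {(x, y)})"
      and chain: "{a, b, x, y} = {u, v, w}" "(u, v) \<in> covering P" "(v, w) \<in> covering P"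
        "u \<in> minimals X P" "w \<in> maximals X P"
        "x \<in> middles X P \<Longrightarrow> I_retractable P b a" "y \<in> middles X P \<Longrightarrow> I_retractable P a b"
      unfolding pair_three_chain_property_def by blast
    then show "\<exists>x y. (x, y) \<in> covering (P - {(a, b)}) \<and>
        x \<in> minimals X (P - {(a, b)}) \<and> y \<in> maximals X (P - {(a, b)}) \<and>
        poset_connected X (P - {(a, b)} - {(x, y)})"
      using three_chain_pair_extremal[OF P ab xy(1) chain] by blast
  qed
next
  note P = \<open>P \<in> posets_on X\<close>
  assume fpp: "has_FPP_graph X P" and shielded: "L_shielded X P"
  have "pair_three_chain_property X P a b"
    if ab: "(a, b) \<in> covering P" and conn: "poset_connected X (P - {(a, b)})" for a b
  proof -
    obtain x y where xy: "(x, y) \<in> covering (P - {(a, b)})"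
        "x \<in> minimals X (P - {(a, b)})" "y \<in> maximals X (P - {(a, b)})"
      and xy_conn: "poset_connected X (P - {(a, b)} - {(x, y)})"
      using shielded ab conn unfolding L_shielded_iff[OF \<open>finite X\<close> P] by blast
    \<comment> \<open>The FPP-graph of \<open>P\<close> concerns deleting \<open>(x, y)\<close>
      alone; restoring \<open>(a, b)\<close> preserves connectedness, so \<open>(x, y)\<close>
      cannot belong to \<open>prec X P\<close>.\<close>
    have "poset_connected X (P - {(x, y)})"
      by (rule poset_connected_mono[OF xy_conn]) blast
    then have "(x, y) \<notin> covering P \<inter> (minimals X P \<times> maximals X P)"
      using fpp unfolding has_FPP_graph_iff[OF P] by blast
    from extremal_pair_three_chain[OF P ab xy this] show ?thesis
      unfolding pair_three_chain_property_def using xy(1) xy_conn by blast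
  qed
  then show "three_chain_property X P"
    unfolding three_chain_property_def by blast
qed

end
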